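(* Fix $T>0$ and consider the channel $$Y(t)=\int_0^t g(s,W_0^s,Y_0^s)\,ds+B(t),\qquad t\in[0,T],$$ where $B$ is a standard Brownian motion, $W=\{W(t):t\in[0,T]\}$ is a process with paths in $C[0,T]$ independent of $B$, and $g:[0,T]\times C[0,T]\times C[0,T]\to\mathbb{R}$. Assume: (d) there is a constant $L>0$ such that for any $0\le s_1,s_2,s_3,t_1,t_2,t_3\le T$ and any $U_0^T,V_0^T,Y_0^T,Z_0^T\in C[0,T]$, $$|g(s_1,U_0^{s_2},Y_0^{s_3})-g(t_1,V_0^{t_2},Z_0^{t_3})|\le L\left(|s_1-t_1|+\|U_0^{s_2}-V_0^{t_2}\|+\|Y_0^{s_3}-Z_0^{t_3}\|\right);$$ (e) there is a constant $L>0$ such that for any $W_0^T,Y_0^T\in C[0,T]$ and $t\in[0,T]$, $|g(t,W_0^t,Y_0^t)|\le L(1+\|W_0^t\|+\|Y_0^t\|)$; (f) there exists $\varepsilon>0$ with $\mathbb{E}[e^{\varepsilon\|W_0^T\|^2}]<\infty$; for any $K>0$ there exists $\varepsilon'>0$ with $\mathbb{E}[e^{K\sup_{|s-t|\le\varepsilon'}(W(s)-W(t))^2}]<\infty$; and there is a constant $L>0$ such that for any $\varepsilon''>0$, $\mathbb{E}[\sup_{|s-t|\le\varepsilon''}(W(s)-W(t))^4]\le L(\varepsilon'')^2$. For each $n\in\mathbb{N}$ let $\Delta_n=\{t_{n,0},\dots,t_{n,n}\}$ with $0=t_{n,0}<t_{n,1}<\cdots<t_{n,n}=T$, and $\delta_{\Delta_n}=\max_{1\le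 i\le n}(t_{n,i}-t_{n,i-1})$. Then for any sequence $\{\Delta_n\}$ with $\delta_{\Delta_n}\to0$ as $n\to\infty$, $$\lim_{n\to\infty}I(W_0^T;Y(\Delta_n))=I(W_0^T;Y_0^T),$$ where $Y(\Delta_n)=\{Y(t_{n,0}),\dots,Y(t_{n,n})\}$.
   Context: For a path or process $U$ and $0\le s\le T$, $U_0^s$ denotes $\{U(r):0\le r\le s\}$. When $U_0^s$ is used as an argument of $g$, it is regarded as an element of $C[0,T]$ by stopping the path at time $s$. Norms: $\|U_0^t\|=\sup_{r\in[0,t]}|U(r)|$, and for $0\le s\le t$, $\|U_0^s-V_0^t\|=\sup_{r\in[0,s]}|U(r)-V(r)|+\sup_{r\in[s,t]}|U(s)-V(r)|$ (and symmetrically if $s>t$). Mutual information: for random elements $U,V$ with laws $\mu_U,\mu_V$ and joint law $\mu_{UV}$, $I(U;V)=\mathbb{E}\left[\log\frac{d\mu_{UV}}{d(\mu_U\times\mu_V)}(U,V)\right]$ if the Radon–Nikodym derivative exists, and $I(U;V)=\infty$ otherwise. *)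

theory Defs
  imports "HOL-Probability.Probability"
begin

text \<open>The space \<open>C[0,T]\<close>: real functions that are continuous on \<open>{0..T}\<close> and undefined
  outside of it (so that equality is equality on \<open>{0..T}\<close>).  The sigma-algebra is generated by the
  evaluations; it is the Borel sigma-algebra of the supremum norm.\<close>

definition path_space :: "real \<Rightarrow> (real \<Rightarrow> real) measure" where
  "path_space T = restrict_space (\<Pi>\<^sub>M t\<in>{0..T}. borel) {f. continuous_on {0..T} f}"

text \<open>The path \<open>U\<close> restricted to \<open>[0,s]\<close>, regarded as an element of \<open>C[0,T]\<close>.\<close>

definition stopped :: "real \<Rightarrow> (real \<Rightarrow> real) \<Rightarrow> real \<Rightarrow> (real \<Rightarrow> real)" where
  "stopped T U s = (\<lambda>r\<in>{0..T}. U (min r s))"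

definition path_norm :: "(real \<Rightarrow> real) \<Rightarrow> real \<Rightarrow> real" where
  "path_norm U t = (SUP r\<in>{0..t}. \<bar>U r\<bar>)"

text \<open>\<open>path_dist U s V t\<close> is the distance between \<open>U\<close> restricted to \<open>[0,s]\<close> and \<open>V\<close> restricted
  to \<open>[0,t]\<close>.\<close>

definition path_dist :: "(real \<Rightarrow> real) \<Rightarrow> real \<Rightarrow> (real \<Rightarrow> real) \<Rightarrow> real \<Rightarrow> real" where
  "path_dist U s V t =
     (if s \<le> t
      then (SUP r\<in>{0..s}. \<bar>U r - V r\<bar>) + (SUP r\<in>{s..t}. \<bar>U s - V r\<bar>)
      else (SUP r\<in>{0..t}. \<bar>U r - V r\<bar>) + (SUP r\<in>{t..s}. \<bar>U r - V t\<bar>))"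

definition close_pairs :: "real \<Rightarrow> real \<Rightarrow> (real \<times> real) set" where
  "close_pairs T \<epsilon> = {(s, t). s \<in> {0..T} \<and> t \<in> {0..T} \<and> \<bar>s - t\<bar> \<le> \<epsilon>}"

definition standard_brownian_motion :: "'a measure \<Rightarrow> real \<Rightarrow> ('a \<Rightarrow> real \<Rightarrow> real) \<Rightarrow> bool" where
  "standard_brownian_motion M T B \<longleftrightarrow>
     B \<in> M \<rightarrow>\<^sub>M path_space T \<and>
     (AE \<omega> in M. B \<omega> 0 = 0) \<and>
     (\<forall>s t. 0 \<le> s \<and> s < t \<and> t \<le> T \<longrightarrow>
        distributed M lborel (\<lambda>\<omega>. B \<omega> t - B \<omega> s) (normal_density 0 (sqrt (t - s)))) \<and>
     (\<forall>(k::nat) t. 0 \<le> t 0 \<and> t k \<le> T \<and> (\<forall>i<k. t i < t (Suc i)) \<longrightarrow>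
        prob_space.indep_vars M (\<lambda>_. borel) (\<lambda>i \<omega>. B \<omega> (t (Suc i)) - B \<omega> (t i)) {..<k})"

text \<open>The expectation, with values in the extended reals, as the difference of the integrals of its
  positive and negative parts, so that the value \<open>\<infinity>\<close> is not lost (the Bochner integral of a
  non-integrable function would be \<open>0\<close>).\<close>

definition ext_expectation :: "'a measure \<Rightarrow> ('a \<Rightarrow> real) \<Rightarrow> ereal" where
  "ext_expectation M f =
     enn2ereal (\<integral>\<^sup>+\<omega>. ennreal (f \<omega>) \<partial>M) - enn2ereal (\<integral>\<^sup>+\<omega>. ennreal (- f \<omega>) \<partial>M)"

text \<open>Unlike the library's \<^const>\<open>prob_space.mutual_information\<close>, this takes the value \<open>\<infinity>\<close> when the
  joint law has no density with respect to the product law, or when the expectation is infinite.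
  The negative part of the logarithm always has finite expectation, so \<open>\<infinity> - \<infinity>\<close> does not occur,
  and the values \<open>0\<close> and \<open>\<infinity>\<close> of the density, where \<^const>\<open>ln\<close> is conventional, are attained at
  \<open>(U, V)\<close> with probability zero.\<close>

definition mutual_info ::
  "'a measure \<Rightarrow> 'b measure \<Rightarrow> 'c measure \<Rightarrow> ('a \<Rightarrow> 'b) \<Rightarrow> ('a \<Rightarrow> 'c) \<Rightarrow> ereal" where
  "mutual_info M S R U V =
     (let \<mu> = distr M S U \<Otimes>\<^sub>M distr M R V;
          \<nu> = distr M (S \<Otimes>\<^sub>M R) (\<lambda>\<omega>. (U \<omega>, V \<omega>))
      in if \<exists>f \<in> borel_measurable \<mu>. density \<mu> f = \<nu>
         then ext_expectation M (\<lambda>\<omega>. ln (enn2real (RN_deriv \<mu> \<nu> (U \<omega>, V \<omega>))))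
         else \<infinity>)"

definition is_partition :: "real \<Rightarrow> nat \<Rightarrow> (nat \<Rightarrow> real) \<Rightarrow> bool" where
  "is_partition T n t \<longleftrightarrow> t 0 = 0 \<and> t n = T \<and> (\<forall>i<n. t i < t (Suc i))"

definition mesh :: "nat \<Rightarrow> (nat \<Rightarrow> real) \<Rightarrow> real" where
  "mesh n t = (MAX i\<in>{1..n}. t i - t (i - 1))"

end

theory Submission
  imports Defs
begin

text \<open>Mutual information is a relative entropy \<open>D(\<nu> | \<mu>)\<close>, where \<open>\<nu>\<close> is the joint law and \<open>\<mu>\<close> the
  product law, and sampling \<open>Y\<close> on \<open>\<Delta>\<^sub>n\<close> pushes both forward.  By the Donsker--Varadhan formula
  \<open>D(\<nu> | \<mu>)\<close> is the supremum of \<open>\<integral>\<phi> d\<nu> - ln \<integral>exp \<phi> d\<mu>\<close> over bounded measurable \<open>\<phi>\<close>.  A test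
  function of the samples is a test function of the path, so sampling does not increase \<open>D\<close>.
  Conversely, the sets that are limits in measure of sets depending only on \<open>W\<close> and \<open>Y(\<Delta>\<^sub>n)\<close> form a
  sigma-algebra, which contains every \<open>{Y(s) < c}\<close> because \<open>Y\<close> is continuous and the mesh tends to
  zero.  Hence every bounded \<open>\<phi>\<close> is an \<open>L\<^sup>1\<close> limit of uniformly bounded test functions of the samples,
  which gives the lower bound, also when the limit is \<open>\<infinity>\<close>.\<close>

section \<open>The Donsker--Varadhan formula\<close>

text \<open>Follows the case distinction of \<open>mutual_info\<close>, with the expectation
  transported from the sample space to the joint law, so that a change of variables identifies the
  two.\<close>

definition kl_divergence :: "'x measure \<Rightarrow> 'x measure \<Rightarrow> ereal" where
  "kl_divergence \<mu> \<nu> =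
     (if \<exists>f \<in> borel_measurable \<mu>. density \<mu> f = \<nu>
      then ext_expectation \<nu> (\<lambda>x. ln (enn2real (RN_deriv \<mu> \<nu> x))) else \<infinity>)"

text \<open>The bound holds on the whole type and not only on the space, so pointwise estimates need
  no membership conditions and composition with any map keeps the bound.\<close>

definition bounded_measurable :: "'x measure \<Rightarrow> ('x \<Rightarrow> real) set" where
  "bounded_measurable X = {\<phi> \<in> borel_measurable X. \<exists>C. \<forall>x. \<bar>\<phi> x\<bar> \<le> C}"

definition dv_functional :: "'x measure \<Rightarrow> 'x measure \<Rightarrow> ('x \<Rightarrow> real) \<Rightarrow> real" where
  "dv_functional \<mu> \<nu> \<phi> = (\<integral>x. \<phi> x \<partial>\<nu>) - ln (\<integral>x. exp (\<phi> x) \<partial>\<mu>)"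

section \<open>Bounded test functions and extended expectations\<close>

lemma (in finite_measure) integrable_bounded_measurable:
  "\<phi> \<in> bounded_measurable M \<Longrightarrow> integrable M \<phi>"
  unfolding bounded_measurable_def by (auto intro!: integrable_const_bound[OF AE_I2])

lemma exp_bounded_measurable:
  assumes "\<phi> \<in> bounded_measurable X"
  shows "(\<lambda>x. exp (\<phi> x)) \<in> bounded_measurable X"
proof -
  from assms obtain C where [measurable]: "\<phi> \<in> borel_measurable X" and C: "\<And>x. \<bar>\<phi> x\<bar> \<le> C"
    by (auto simp: bounded_measurable_def)
  have "\<bar>exp (\<phi> x)\<bar> \<le> exp C" for x
    using C[of x] by simp
  then show ?thesis
    by (auto simp: bounded_measurable_def)
qed

text \<open>Keeps the argument of \<open>ln\<close> in \<open>dv_functional\<close> away from zero,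
  with an explicit bound on which the stability estimate for the logarithm rests.\<close>

lemma (in prob_space) integral_exp_ge:
  fixes \<phi> :: "'a \<Rightarrow> real"
  assumes [measurable]: "\<phi> \<in> borel_measurable M" and C: "\<And>x. \<bar>\<phi> x\<bar> \<le> C"
  shows "exp (- C) \<le> (\<integral>x. exp (\<phi> x) \<partial>M)"
proof -
  have "integrable M (\<lambda>x. exp (\<phi> x))"
    by (intro integrable_bounded_measurable exp_bounded_measurable)
      (use assms in \<open>auto simp: bounded_measurable_def\<close>)
  moreover have "- C \<le> \<phi> x" for x
    using C[of x] by simp
  ultimately have "(\<integral>x. exp (- C) \<partial>M) \<le> (\<integral>x. exp (\<phi> x) \<partial>M)"
    by (intro integral_mono) auto
  then show ?thesis
    by (simp add: prob_space)
qed

lemma ext_expectation_eq_integral: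
  assumes "integrable M f"
  shows "ext_expectation M f = ereal (\<integral>x. f x \<partial>M)"
proof -
  have "(\<integral>\<^sup>+x. ennreal (f x) \<partial>M) < \<infinity>" "(\<integral>\<^sup>+x. ennreal (- f x) \<partial>M) < \<infinity>"
    using assms by (auto simp: real_integrable_def top.not_eq_extremum)
  then show ?thesis
    unfolding ext_expectation_def real_lebesgue_integral_def[OF assms]
    by (cases "\<integral>\<^sup>+x. ennreal (f x) \<partial>M"; cases "\<integral>\<^sup>+x. ennreal (- f x) \<partial>M") (auto simp: enn2ereal_ennreal)
qed

lemma ext_expectation_distr:
  assumes "f \<in> M \<rightarrow>\<^sub>M N" "h \<in> borel_measurable N"
  shows "ext_expectation (distr M N f) h = ext_expectation M (\<lambda>x. h (f x))"
  using assms by (simp add: ext_expectation_def nn_integral_distr)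

text \<open>A real-valued density \<open>h\<close> stands in for \<open>RN_deriv\<close>, which is
  \<open>ennreal\<close>-valued and may be infinite on a null set.\<close>

locale density_pair =
  fixes \<mu> \<nu> :: "'x measure" and h :: "'x \<Rightarrow> real"
  assumes prob_\<mu>: "prob_space \<mu>" and prob_\<nu>: "prob_space \<nu>"
    and h_measurable [measurable]: "h \<in> borel_measurable \<mu>" and h_nonneg: "\<And>x. 0 \<le> h x"
    and \<nu>_eq: "\<nu> = density \<mu> (\<lambda>x. ennreal (h x))"
begin

sublocale \<mu>: prob_space \<mu> by (rule prob_\<mu>)
sublocale \<nu>: prob_space \<nu> by (rule prob_\<nu>)

lemma sets_eq [measurable_cong, simp]: "sets \<nu> = sets \<mu>"
  by (simp add: \<nu>_eq)

lemma space_eq [simp]: "space \<nu> = space \<mu>"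
  by (simp add: \<nu>_eq)

lemma measure_space_eq_1 [simp]: "measure \<nu> (space \<mu>) = 1"
  using \<nu>.prob_space by simp

lemma nn_integral_h: "(\<integral>\<^sup>+x. ennreal (h x) \<partial>\<mu>) = 1"
proof -
  have "(\<integral>\<^sup>+x. ennreal (h x) \<partial>\<mu>) = emeasure (density \<mu> (\<lambda>x. ennreal (h x))) (space \<mu>)"
    by (subst emeasure_density) (auto intro!: nn_integral_cong)
  then show ?thesis
    using \<nu>.emeasure_space_1 by (simp flip: \<nu>_eq)
qed

lemma integrable_h: "integrable \<mu> h" and integral_h: "(\<integral>x. h x \<partial>\<mu>) = 1"
proof -
  have "has_bochner_integral \<mu> h 1"
    using h_nonneg nn_integral_h by (intro has_bochner_integral_nn_integral) auto
  then show "integrable \<mu> h" "(\<integral>x. h x \<partial>\<mu>) = 1"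
    by (auto simp: has_bochner_integral_iff)
qed

lemma AE_h_pos: "AE x in \<nu>. 0 < h x"
  unfolding \<nu>_eq using h_nonneg by (subst AE_density) auto

text \<open>Under \<open>\<nu>\<close> the integrand is weighted by \<open>h\<close>, and
  \<open>ln t \<le> t - 1\<close> at \<open>t = 1 / h\<close> gives
  \<open>- h ln h \<le> 1 - h \<le> 1\<close>. Hence the extended expectation of \<open>ln h\<close>
  is never \<open>\<infinity> - \<infinity>\<close>.\<close>

lemma nn_integral_neg_ln_le: "(\<integral>\<^sup>+x. ennreal (- ln (h x)) \<partial>\<nu>) \<le> 1"
proof -
  have "h x * (- ln (h x)) \<le> 1" for x
  proof (cases "h x = 0")
    case False
    then have pos: "0 < h x"
      using h_nonneg[of x] by simp
    then have "- ln (h x) \<le> 1 / h x - 1"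
      using ln_le_minus_one[of "1 / h x"] by (simp add: ln_div)
    then have "h x * (- ln (h x)) \<le> h x * (1 / h x - 1)"
      using pos by (intro mult_left_mono) auto
    also have "\<dots> \<le> 1"
      using pos by (simp add: field_simps)
    finally show ?thesis .
  qed simp
  then have "(\<integral>\<^sup>+x. ennreal (h x) * ennreal (- ln (h x)) \<partial>\<mu>) \<le> (\<integral>\<^sup>+x. 1 \<partial>\<mu>)"
    by (intro nn_integral_mono) (auto simp flip: ennreal_mult' simp: h_nonneg ennreal_le_1)
  then show ?thesis
    unfolding \<nu>_eq by (subst nn_integral_density) (auto simp: \<mu>.emeasure_space_1)
qed

text \<open>Gibbs' inequality against the tilted probability density \<open>exp \<phi> / c\<close>.
  If \<open>q\<close> is its ratio to \<open>h\<close>, then \<open>ln q \<le> q - 1\<close> holds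
  almost everywhere under \<open>\<nu>\<close>, and the mean of \<open>q\<close> is at most
  1.\<close>

lemma dv_functional_le:
  assumes \<phi>: "\<phi> \<in> bounded_measurable \<mu>"
  shows "ereal (dv_functional \<mu> \<nu> \<phi>) \<le> ext_expectation \<nu> (\<lambda>x. ln (h x))"
proof (cases "(\<integral>\<^sup>+x. ennreal (ln (h x)) \<partial>\<nu>) = \<infinity>")
  \<comment> \<open>The negative part has mean at most 1, so an infinite positive part forces the
    value \<open>\<infinity>\<close>.\<close>
  case True
  obtain r where "(\<integral>\<^sup>+x. ennreal (- ln (h x)) \<partial>\<nu>) = ennreal r" "0 \<le> r"
    using nn_integral_neg_ln_le by (cases "\<integral>\<^sup>+x. ennreal (- ln (h x)) \<partial>\<nu>") (auto simp: top_unique)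
  then show ?thesis
    by (simp add: ext_expectation_def True enn2ereal_ennreal)
next
  case False
  then have int_ln: "integrable \<nu> (\<lambda>x. ln (h x))"
    using nn_integral_neg_ln_le by (auto simp: real_integrable_def top_unique)
  from \<phi> obtain C where [measurable]: "\<phi> \<in> borel_measurable \<mu>" and C: "\<And>x. \<bar>\<phi> x\<bar> \<le> C"
    by (auto simp: bounded_measurable_def)
  define c where "c = (\<integral>x. exp (\<phi> x) \<partial>\<mu>)"
  have c_pos: "0 < c"
    unfolding c_def using \<mu>.integral_exp_ge[of \<phi>, OF _ C] exp_gt_zero[of "- C"]
    by (meson less_le_trans \<open>\<phi> \<in> borel_measurable \<mu>\<close>)
  have int_\<phi>: "integrable \<nu> \<phi>"
    using \<phi> by (intro \<nu>.integrable_bounded_measurable) (simp add: bounded_measurable_def)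
  have int_exp: "integrable \<mu> (\<lambda>x. exp (\<phi> x))"
    using \<phi> by (intro \<mu>.integrable_bounded_measurable exp_bounded_measurable)
  define q where "q x = exp (\<phi> x) / (c * h x)" for x
  have [measurable]: "q \<in> borel_measurable \<mu>"
    unfolding q_def by measurable
  \<comment> \<open>Where \<open>h x = 0\<close>, division by zero makes \<open>q x = 0\<close>. The
    upper bound is then strict: tilted mass outside the support of \<open>h\<close> is lost, which
    is the favourable direction.\<close>
  have hq: "0 \<le> h x * q x \<and> h x * q x \<le> exp (\<phi> x) / c" for x
    using c_pos h_nonneg[of x] by (auto simp: q_def field_simps)
  have int_hq: "integrable \<mu> (\<lambda>x. h x * q x)"
    by (rule Bochner_Integration.integrable_bound[of _ "\<lambda>x. exp (\<phi> x) / c"])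
      (use hq int_exp c_pos in \<open>auto simp: abs_of_nonneg\<close>)
  then have int_q: "integrable \<nu> q"
    unfolding \<nu>_eq by (subst integrable_density) (auto simp: h_nonneg)
  have "(\<integral>x. q x \<partial>\<nu>) = (\<integral>x. h x * q x \<partial>\<mu>)"
    unfolding \<nu>_eq by (subst integral_density) (auto simp: h_nonneg)
  also have "\<dots> \<le> (\<integral>x. exp (\<phi> x) / c \<partial>\<mu>)"
    using hq int_hq int_exp by (intro integral_mono) auto
  also have "\<dots> = 1"
    using c_pos by (simp add: c_def)
  finally have q_le: "(\<integral>x. q x \<partial>\<nu>) \<le> 1" .
  have "(\<integral>x. \<phi> x - ln c - ln (h x) \<partial>\<nu>) \<le> (\<integral>x. q x - 1 \<partial>\<nu>)"
  proof (rule integral_mono_AE)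
    show "AE x in \<nu>. \<phi> x - ln c - ln (h x) \<le> q x - 1"
      using AE_h_pos
    proof eventually_elim
      case (elim x)
      then have "q x = exp (\<phi> x - ln c - ln (h x))"
        using c_pos by (simp add: q_def exp_diff)
      then show ?case
        using exp_ge_add_one_self[of "\<phi> x - ln c - ln (h x)"] by linarith
    qed
  qed (use int_\<phi> int_ln int_q in auto)
  then have "(\<integral>x. \<phi> x \<partial>\<nu>) - ln c \<le> (\<integral>x. ln (h x) \<partial>\<nu>)"
    using q_le int_\<phi> int_ln int_q by simp
  then show ?thesis
    by (simp add: ext_expectation_eq_integral[OF int_ln] dv_functional_def c_def)
qed

lemma ext_expectation_le_dv:
  "ext_expectation \<nu> (\<lambda>x. ln (h x)) \<le> (SUP \<phi>\<in>bounded_measurable \<mu>. ereal (dv_functional \<mu> \<nu> \<phi>))"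
proof -
  text \<open>The truncations of \<open>ln (h x)\<close> to \<open>[-k, k]\<close> are a maximizing sequence; where \<open>h\<close> vanishes the
    library's \<open>ln 0 = 0\<close> has to be replaced by \<open>-k\<close>.\<close>
  define P where "P = (\<integral>\<^sup>+x. ennreal (ln (h x)) \<partial>\<nu>)"
  define N where "N = (\<integral>\<^sup>+x. ennreal (- ln (h x)) \<partial>\<nu>)"
  define P' where "P' k = (\<integral>\<^sup>+x. ennreal (min (real k) (ln (h x))) \<partial>\<nu>)" for k
  define \<phi> where "\<phi> k x = (if h x = 0 then - real k else max (- real k) (min (real k) (ln (h x))))" for k x
  have N_le: "N \<le> 1"
    unfolding N_def by (rule nn_integral_neg_ln_le)
  have P'_lim: "P' \<longlonglongrightarrow> P"
    unfolding P'_def P_def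
  proof (rule nn_integral_LIMSEQ)
    show "incseq (\<lambda>k x. ennreal (min (real k) (ln (h x))))"
      by (auto simp: incseq_def le_fun_def intro!: ennreal_leI min.mono)
    show "(\<lambda>k. ennreal (min (real k) (ln (h x)))) \<longlonglongrightarrow> ennreal (ln (h x))" for x
    proof (rule tendsto_eventually)
      obtain m where "ln (h x) \<le> real m"
        using real_arch_simple by blast
      then show "\<forall>\<^sub>F k in sequentially. ennreal (min (real k) (ln (h x))) = ennreal (ln (h x))"
        by (intro eventually_sequentiallyI[of m]) (auto simp: min_def)
    qed
  qed measurable
  \<comment> \<open>Finiteness of each \<open>P' k\<close> lets the extended-real lower bounds at
    the end be read as real ones.\<close>
  have P'_le: "P' k \<le> ennreal k" for k
  proof -
    have "P' k \<le> (\<integral>\<^sup>+x. ennreal k \<partial>\<nu>)"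
      unfolding P'_def by (intro nn_integral_mono ennreal_leI) auto
    then show ?thesis
      using \<nu>.emeasure_space_1 by simp
  qed
  have \<phi>_bm: "\<phi> k \<in> bounded_measurable \<mu>" for k
    unfolding bounded_measurable_def \<phi>_def by (auto intro!: exI[of _ "real k"])
  \<comment> \<open>The loss \<open>ln (1 + exp (- real k))\<close> is the price of truncating from
    below: \<open>exp (\<phi> k x) \<le> h x + exp (- real k)\<close>, and the right-hand side has
    integral \<open>1 + exp (- real k)\<close> under \<open>\<mu>\<close>.\<close>
  have dv_ge: "enn2real (P' k) - enn2real N - ln (1 + exp (- real k)) \<le> dv_functional \<mu> \<nu> (\<phi> k)" for k
  proof -
    have [measurable]: "\<phi> k \<in> borel_measurable \<mu>"
      using \<phi>_bm by (auto simp: bounded_measurable_def)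
    have int_\<phi>: "integrable \<nu> (\<phi> k)"
      using \<phi>_bm by (intro \<nu>.integrable_bounded_measurable) (simp add: bounded_measurable_def)
    have 1: "(\<integral>\<^sup>+x. ennreal (\<phi> k x) \<partial>\<nu>) = P' k"
      unfolding P'_def using AE_h_pos
      by (intro nn_integral_cong_AE) (auto elim!: eventually_mono simp: \<phi>_def max_def ennreal_eq_0_iff ennreal_neg)
    have 2: "(\<integral>\<^sup>+x. ennreal (- \<phi> k x) \<partial>\<nu>) \<le> N"
      unfolding N_def
    proof (rule nn_integral_mono_AE)
      show "AE x in \<nu>. ennreal (- \<phi> k x) \<le> ennreal (- ln (h x))"
        using AE_h_pos
      proof eventually_elim
        case (elim x)
        then have "- \<phi> k x \<le> max 0 (- ln (h x))"
          by (auto simp: \<phi>_def)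
        then have "ennreal (- \<phi> k x) \<le> ennreal (max 0 (- ln (h x)))"
          by (rule ennreal_leI)
        then show ?case
          by simp
      qed
    qed
    have "enn2real (\<integral>\<^sup>+x. ennreal (- \<phi> k x) \<partial>\<nu>) \<le> enn2real N"
      by (rule enn2real_mono[OF 2]) (use N_le in \<open>auto intro: le_less_trans\<close>)
    then have int_ge: "enn2real (P' k) - enn2real N \<le> (\<integral>x. \<phi> k x \<partial>\<nu>)"
      by (simp add: real_lebesgue_integral_def[OF int_\<phi>] 1)
    have "exp (\<phi> k x) \<le> h x + exp (- real k)" for x
    proof (cases "h x = 0")
      case False
      then have "exp (ln (h x)) = h x"
        using h_nonneg[of x] by simp
      moreover have "exp (\<phi> k x) \<le> max (exp (- real k)) (exp (ln (h x)))"
        using False by (auto simp: \<phi>_def max_def min_def)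
      ultimately show ?thesis
        using h_nonneg[of x] exp_gt_zero[of "- real k"] by linarith
    qed (simp add: \<phi>_def)
    then have "(\<integral>x. exp (\<phi> k x) \<partial>\<mu>) \<le> (\<integral>x. h x + exp (- real k) \<partial>\<mu>)"
      using integrable_h \<mu>.integrable_bounded_measurable[OF exp_bounded_measurable[OF \<phi>_bm]]
      by (intro integral_mono) auto
    also have "\<dots> = 1 + exp (- real k)"
      using integrable_h by (simp add: integral_h \<mu>.prob_space)
    finally have exp_le: "(\<integral>x. exp (\<phi> k x) \<partial>\<mu>) \<le> 1 + exp (- real k)" .
    have "0 < (\<integral>x. exp (\<phi> k x) \<partial>\<mu>)"
    proof -
      have "exp (- real k) \<le> (\<integral>x. exp (\<phi> k x) \<partial>\<mu>)"
        by (rule \<mu>.integral_exp_ge) (auto simp: \<phi>_def)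
      then show ?thesis
        using exp_gt_zero[of "- real k"] by linarith
    qed
    then have "ln (\<integral>x. exp (\<phi> k x) \<partial>\<mu>) \<le> ln (1 + exp (- real k))"
      using exp_le by (simp add: add_pos_pos)
    then show ?thesis
      using int_ge by (simp add: dv_functional_def)
  qed
  \<comment> \<open>The vanishing term \<open>ln 1\<close> is kept so that the right-hand side has
    the shape of the limit of the bounds in \<open>dv_ge\<close>.\<close>
  have ext: "ext_expectation \<nu> (\<lambda>x. ln (h x)) = enn2ereal P - ereal (enn2real N) - ereal (ln 1)"
    using N_le unfolding ext_expectation_def P_def[symmetric] N_def[symmetric]
    by (cases N) (auto simp: enn2ereal_ennreal top_unique simp flip: zero_ereal_def)
  have "(\<lambda>k. enn2ereal (P' k) - ereal (enn2real N) - ereal (ln (1 + exp (- real k))))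
      \<longlonglongrightarrow> enn2ereal P - ereal (enn2real N) - ereal (ln 1)"
  proof (intro tendsto_diff_ereal_general tendsto_ereal tendsto_const)
    have "(\<lambda>k. exp (- real k)) \<longlonglongrightarrow> 0"
      by (intro filterlim_compose[OF exp_at_bot] filterlim_uminus_at_bot_at_top[THEN filterlim_compose]
          filterlim_real_sequentially)
    then have "(\<lambda>k. ln (1 + exp (- real k))) \<longlonglongrightarrow> ln (1 + 0)"
      by (intro tendsto_ln tendsto_add tendsto_const) auto
    then show "(\<lambda>k. ln (1 + exp (- real k))) \<longlonglongrightarrow> ln 1"
      by simp
    show "(\<lambda>k. enn2ereal (P' k)) \<longlonglongrightarrow> enn2ereal P"
      using P'_lim by (intro continuous_on_tendsto_compose[OF continuous_on_enn2ereal]) auto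
  qed auto
  moreover have "enn2ereal (P' k) - ereal (enn2real N) - ereal (ln (1 + exp (- real k)))
      \<le> (SUP \<phi>\<in>bounded_measurable \<mu>. ereal (dv_functional \<mu> \<nu> \<phi>))" for k
  proof (rule SUP_upper2[OF \<phi>_bm[of k]])
    show "enn2ereal (P' k) - ereal (enn2real N) - ereal (ln (1 + exp (- real k)))
        \<le> ereal (dv_functional \<mu> \<nu> (\<phi> k))"
      using dv_ge[of k] P'_le[of k] by (cases "P' k") (auto simp: enn2ereal_ennreal top_unique)
  qed
  ultimately show ?thesis
    unfolding ext by (intro LIMSEQ_le_const2) auto
qed

end

text \<open>A multiple of the indicator of \<open>A\<close> costs nothing in the logarithmic term,
  since its exponential is 1 almost everywhere under \<open>\<mu>\<close>, while its mean under
  \<open>\<nu>\<close> grows linearly with the multiple.\<close>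

lemma dv_functional_unbounded:
  assumes \<mu>: "prob_space \<mu>" and \<nu>: "prob_space \<nu>" and sets: "sets \<nu> = sets \<mu>"
    and A: "A \<in> null_sets \<mu>" "A \<notin> null_sets \<nu>"
  shows "(SUP \<phi>\<in>bounded_measurable \<mu>. ereal (dv_functional \<mu> \<nu> \<phi>)) = \<infinity>"
proof (rule SUP_PInfty)
  interpret \<mu>: prob_space \<mu> by fact
  interpret \<nu>: prob_space \<nu> by fact
  have [measurable]: "A \<in> sets \<mu>" "A \<in> sets \<nu>"
    using A sets by auto
  have pos: "0 < measure \<nu> A"
    using A(2) \<open>A \<in> sets \<nu>\<close> by (auto simp: null_sets_def \<nu>.emeasure_eq_measure zero_less_measure_iff)
  fix n :: nat
  define c where "c = real n / measure \<nu> A"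
  define \<phi> where "\<phi> x = c * indicator A x" for x
  have "(\<integral>x. exp (\<phi> x) \<partial>\<mu>) = (\<integral>x. 1 \<partial>\<mu>)"
  proof (rule integral_cong_AE)
    show "AE x in \<mu>. exp (\<phi> x) = 1"
      using AE_not_in[OF A(1)] by eventually_elim (simp add: \<phi>_def)
  qed (auto simp: \<phi>_def)
  then have "dv_functional \<mu> \<nu> \<phi> = n"
    using pos \<open>A \<in> sets \<nu>\<close> sets.sets_into_space[of A \<nu>]
    by (simp add: dv_functional_def \<mu>.prob_space \<phi>_def c_def Int_absorb2)
  moreover have "\<phi> \<in> bounded_measurable \<mu>"
    unfolding bounded_measurable_def \<phi>_def
    by (auto intro!: exI[of _ "\<bar>c\<bar>"] simp: indicator_def)
  ultimately show "\<exists>\<phi>\<in>bounded_measurable \<mu>. ereal (real n) \<le> ereal (dv_functional \<mu> \<nu> \<phi>)"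
    by (intro bexI[of _ \<phi>]) auto
qed

text \<open>If a density exists, its real version satisfies \<open>density_pair\<close>, which gives
  both inequalities. Otherwise absolute continuity fails by Radon-Nikodym, and a set that is null
  for \<open>\<mu>\<close> but not for \<open>\<nu>\<close> makes both sides infinite.\<close>

theorem donsker_varadhan:
  assumes \<mu>: "prob_space \<mu>" and \<nu>: "prob_space \<nu>" and sets: "sets \<nu> = sets \<mu>"
  shows "kl_divergence \<mu> \<nu> = (SUP \<phi>\<in>bounded_measurable \<mu>. ereal (dv_functional \<mu> \<nu> \<phi>))"
proof (cases "\<exists>f \<in> borel_measurable \<mu>. density \<mu> f = \<nu>")
  case True
  interpret \<mu>: prob_space \<mu> by fact
  interpret \<nu>: prob_space \<nu> by fact
  define h where "h x = enn2real (RN_deriv \<mu> \<nu> x)" for x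
  from True have dens: "density \<mu> (RN_deriv \<mu> \<nu>) = \<nu>"
    by (auto intro: RN_derivI)
  have "absolutely_continuous \<mu> \<nu>"
    using absolutely_continuousI_density[of "RN_deriv \<mu> \<nu>" \<mu>] dens by simp
  \<comment> \<open>Hence \<open>enn2real\<close>, which sends \<open>\<infinity>\<close> to 0,
    alters the derivative only on a null set.\<close>
  then have "AE x in \<mu>. RN_deriv \<mu> \<nu> x \<noteq> \<infinity>"
    using sets by (intro \<mu>.RN_deriv_finite \<nu>.sigma_finite_measure_axioms)
  then have "density \<mu> (\<lambda>x. ennreal (h x)) = density \<mu> (RN_deriv \<mu> \<nu>)"
    by (intro density_cong) (auto elim!: eventually_mono simp: h_def top.not_eq_extremum)
  moreover have "h \<in> borel_measurable \<mu>" "0 \<le> h x" for x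
    unfolding h_def by simp_all
  ultimately interpret density_pair \<mu> \<nu> h
    using dens by (intro density_pair.intro \<mu> \<nu>) simp_all
  have "kl_divergence \<mu> \<nu> = ext_expectation \<nu> (\<lambda>x. ln (h x))"
    unfolding kl_divergence_def h_def using True by (rule if_P)
  then show ?thesis
    using dv_functional_le ext_expectation_le_dv by (simp add: antisym SUP_least)
next
  case False
  interpret \<mu>: prob_space \<mu> by fact
  from False have "\<not> absolutely_continuous \<mu> \<nu>"
    using \<mu>.Radon_Nikodym sets by blast
  then obtain A where "A \<in> null_sets \<mu>" "A \<notin> null_sets \<nu>"
    by (auto simp: absolutely_continuous_def)
  with False show ?thesis
    using dv_functional_unbounded[OF assms] by (simp add: kl_divergence_def)
qed

section \<open>Data processing and stability of the variational functional\<close>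

lemma dv_functional_le_kl_divergence:
  assumes "prob_space \<mu>" "prob_space \<nu>" "sets \<nu> = sets \<mu>" "\<phi> \<in> bounded_measurable \<mu>"
  shows "ereal (dv_functional \<mu> \<nu> \<phi>) \<le> kl_divergence \<mu> \<nu>"
  unfolding donsker_varadhan[OF assms(1-3)] using assms(4) by (rule SUP_upper)

lemma dv_functional_distr:
  assumes p: "p \<in> \<mu> \<rightarrow>\<^sub>M R" and sets: "sets \<nu> = sets \<mu>" and \<psi>: "\<psi> \<in> borel_measurable R"
  shows "dv_functional (distr \<mu> R p) (distr \<nu> R p) \<psi> = dv_functional \<mu> \<nu> (\<lambda>x. \<psi> (p x))"
proof -
  have "p \<in> \<nu> \<rightarrow>\<^sub>M R"
    using p sets by (simp cong: measurable_cong_sets)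
  with p \<psi> show ?thesis
    by (simp add: dv_functional_def integral_distr)
qed

text \<open>The data processing inequality: a test function \<open>\<psi>\<close> on the image pulls
  back to \<open>\<psi> \<circ> p\<close> with the same value of the functional, so the supremum on
  the left runs over fewer test functions.\<close>

lemma kl_divergence_distr_le:
  assumes \<mu>: "prob_space \<mu>" and \<nu>: "prob_space \<nu>" and sets: "sets \<nu> = sets \<mu>"
    and p: "p \<in> \<mu> \<rightarrow>\<^sub>M R"
  shows "kl_divergence (distr \<mu> R p) (distr \<nu> R p) \<le> kl_divergence \<mu> \<nu>"
proof -
  have p': "p \<in> \<nu> \<rightarrow>\<^sub>M R"
    using p sets by (simp cong: measurable_cong_sets)
  have "kl_divergence (distr \<mu> R p) (distr \<nu> R p) =
      (SUP \<psi>\<in>bounded_measurable (distr \<mu> R p). ereal (dv_functional (distr \<mu> R p) (distr \<nu> R p) \<psi>))"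
    using \<mu> \<nu> p p' by (intro donsker_varadhan prob_space.prob_space_distr) auto
  also have "\<dots> \<le> kl_divergence \<mu> \<nu>"
  proof (rule SUP_least)
    fix \<psi> assume "\<psi> \<in> bounded_measurable (distr \<mu> R p)"
    then have \<psi>: "\<psi> \<in> borel_measurable R" "\<exists>C. \<forall>x. \<bar>\<psi> x\<bar> \<le> C"
      by (auto simp: bounded_measurable_def)
    then have "(\<lambda>x. \<psi> (p x)) \<in> bounded_measurable \<mu>"
      using p by (auto simp: bounded_measurable_def)
    then have "ereal (dv_functional \<mu> \<nu> (\<lambda>x. \<psi> (p x))) \<le> kl_divergence \<mu> \<nu>"
      by (rule dv_functional_le_kl_divergence[OF \<mu> \<nu> sets])
    then show "ereal (dv_functional (distr \<mu> R p) (distr \<nu> R p) \<psi>) \<le> kl_divergence \<mu> \<nu>"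
      by (simp add: dv_functional_distr[OF p sets \<psi>(1)])
  qed
  finally show ?thesis .
qed

text \<open>The linear term changes by at most \<open>e\<close>. The logarithmic term contributes
  \<open>exp C\<close> from the slope of \<open>exp\<close> on \<open>[-C, C]\<close> and another
  \<open>exp C\<close> from the slope of \<open>ln\<close> above \<open>exp (- C)\<close>. The
  one-sided bound is what a lower bound on a supremum requires.\<close>

lemma dv_functional_perturb:
  assumes \<mu>: "prob_space \<mu>" and \<nu>: "prob_space \<nu>" and sets: "sets \<nu> = sets \<mu>"
    and meas: "\<phi> \<in> borel_measurable \<mu>" "\<psi> \<in> borel_measurable \<mu>"
    and C: "\<And>x. \<bar>\<phi> x\<bar> \<le> C" "\<And>x. \<bar>\<psi> x\<bar> \<le> C"
    and le: "(\<integral>x. \<bar>\<phi> x - \<psi> x\<bar> \<partial>\<mu>) \<le> e" "(\<integral>x. \<bar>\<phi> x - \<psi> x\<bar> \<partial>\<nu>) \<le> e"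
  shows "dv_functional \<mu> \<nu> \<phi> - (1 + exp (2 * C)) * e \<le> dv_functional \<mu> \<nu> \<psi>"
proof -
  interpret \<mu>: prob_space \<mu> by fact
  interpret \<nu>: prob_space \<nu> by fact
  have bm: "\<phi> \<in> bounded_measurable \<mu>" "\<psi> \<in> bounded_measurable \<mu>"
      "\<phi> \<in> bounded_measurable \<nu>" "\<psi> \<in> bounded_measurable \<nu>"
    using meas C sets by (auto simp: bounded_measurable_def cong: measurable_cong_sets)
  note int = \<mu>.integrable_bounded_measurable[OF bm(1)] \<mu>.integrable_bounded_measurable[OF bm(2)]
    \<nu>.integrable_bounded_measurable[OF bm(3)] \<nu>.integrable_bounded_measurable[OF bm(4)]
    \<mu>.integrable_bounded_measurable[OF exp_bounded_measurable[OF bm(1)]]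
    \<mu>.integrable_bounded_measurable[OF exp_bounded_measurable[OF bm(2)]]
  define a where "a = (\<integral>x. exp (\<phi> x) \<partial>\<mu>)"
  define b where "b = (\<integral>x. exp (\<psi> x) \<partial>\<mu>)"
  have a: "exp (- C) \<le> a" and b: "exp (- C) \<le> b"
    unfolding a_def b_def by (intro \<mu>.integral_exp_ge meas C)+
  then have pos: "0 < a" "0 < b"
    using exp_gt_zero[of "- C"] by linarith+
  have "(\<integral>x. \<phi> x \<partial>\<nu>) - (\<integral>x. \<psi> x \<partial>\<nu>) = (\<integral>x. \<phi> x - \<psi> x \<partial>\<nu>)"
    using int by simp
  also have "\<dots> \<le> (\<integral>x. \<bar>\<phi> x - \<psi> x\<bar> \<partial>\<nu>)"
    using int by (intro integral_mono) auto
  finally have 1: "(\<integral>x. \<phi> x \<partial>\<nu>) - (\<integral>x. \<psi> x \<partial>\<nu>) \<le> e"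
    using le by linarith
  \<comment> \<open>Convexity: the graph of \<open>exp\<close> lies above its tangent at
    \<open>\<psi> x\<close>.\<close>
  have "exp (\<psi> x) - exp (\<phi> x) \<le> exp C * \<bar>\<phi> x - \<psi> x\<bar>" for x
  proof -
    have "exp (\<psi> x) * (1 + (\<phi> x - \<psi> x)) \<le> exp (\<psi> x) * exp (\<phi> x - \<psi> x)"
      by (intro mult_left_mono exp_ge_add_one_self) auto
    then have "exp (\<psi> x) - exp (\<phi> x) \<le> exp (\<psi> x) * (\<psi> x - \<phi> x)"
      by (simp add: exp_diff algebra_simps)
    also have "\<dots> \<le> exp (\<psi> x) * \<bar>\<phi> x - \<psi> x\<bar>"
      by (intro mult_left_mono) auto
    also have "\<dots> \<le> exp C * \<bar>\<phi> x - \<psi> x\<bar>"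
      using C(2)[of x] by (intro mult_right_mono) auto
    finally show ?thesis .
  qed
  then have "(\<integral>x. exp (\<psi> x) - exp (\<phi> x) \<partial>\<mu>) \<le> (\<integral>x. exp C * \<bar>\<phi> x - \<psi> x\<bar> \<partial>\<mu>)"
    using int by (intro integral_mono) auto
  also have "\<dots> \<le> exp C * e"
    using le by simp
  finally have ba: "b - a \<le> exp C * e"
    using int by (simp add: a_def b_def)
  have e: "0 \<le> e"
    using le(1) Bochner_Integration.integral_nonneg[of \<mu> "\<lambda>x. \<bar>\<phi> x - \<psi> x\<bar>"] by linarith
  have "ln b - ln a \<le> (b - a) / a"
    using pos by (intro ln_diff_le)
  also have "\<dots> \<le> (exp C * e) / exp (- C)"
    using ba pos e a by (intro frac_le) auto
  also have "\<dots> = exp (2 * C) * e"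
    by (simp add: exp_minus field_simps flip: exp_add)
  finally show ?thesis
    using 1 by (simp add: dv_functional_def a_def b_def algebra_simps)
qed

section \<open>Approximation of events by partial observations\<close>

text \<open>The events visible through \<open>p n\<close> need not increase with \<open>n\<close>,
  as partitions need not refine each other. Closeness to some visible event is therefore demanded
  for all large \<open>n\<close>, in the pseudometric given by the measure of the symmetric
  difference.\<close>

definition approximable ::
  "'x measure \<Rightarrow> (nat \<Rightarrow> 'y measure) \<Rightarrow> (nat \<Rightarrow> 'x \<Rightarrow> 'y) \<Rightarrow> 'x set \<Rightarrow> bool" where
  "approximable \<rho> R p A \<longleftrightarrow> A \<in> sets \<rho> \<and>
     (\<forall>e>0. \<forall>\<^sub>F n in sequentially. \<exists>C\<in>sets (R n).
        measure \<rho> (sym_diff A (p n -` C \<inter> space \<rho>)) < e)"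

lemma approximable_exact:
  assumes "A \<in> sets \<rho>" "\<And>n. \<exists>C\<in>sets (R n). p n -` C \<inter> space \<rho> = A"
  shows "approximable \<rho> R p A"
  unfolding approximable_def
proof (intro conjI allI impI always_eventually)
  fix e :: real and n
  assume "0 < e"
  from assms(2)[of n] obtain C where "C \<in> sets (R n)" "p n -` C \<inter> space \<rho> = A"
    by blast
  with \<open>0 < e\<close> show "\<exists>C\<in>sets (R n). measure \<rho> (sym_diff A (p n -` C \<inter> space \<rho>)) < e"
    by (intro bexI[of _ C]) simp_all
qed fact

text \<open>Complementing two sets leaves their symmetric difference unchanged.\<close>

lemma approximable_Diff:
  assumes p: "\<And>n. p n \<in> \<rho> \<rightarrow>\<^sub>M R n" and A: "approximable \<rho> R p A"
  shows "approximable \<rho> R p (space \<rho> - A)"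
  unfolding approximable_def
proof (intro conjI allI impI)
  show "space \<rho> - A \<in> sets \<rho>"
    using A by (auto simp: approximable_def)
  fix e :: real assume "0 < e"
  with A have "\<forall>\<^sub>F n in sequentially. \<exists>C\<in>sets (R n). measure \<rho> (sym_diff A (p n -` C \<inter> space \<rho>)) < e"
    by (auto simp: approximable_def)
  then show "\<forall>\<^sub>F n in sequentially. \<exists>C\<in>sets (R n).
      measure \<rho> (sym_diff (space \<rho> - A) (p n -` C \<inter> space \<rho>)) < e"
  proof eventually_elim
    case (elim n)
    then obtain C where C: "C \<in> sets (R n)" "measure \<rho> (sym_diff A (p n -` C \<inter> space \<rho>)) < e"
      by blast
    have "A \<subseteq> space \<rho>"
      using A sets.sets_into_space by (auto simp: approximable_def)
    then have "sym_diff (space \<rho> - A) (p n -` (space (R n) - C) \<inter> space \<rho>) =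
        sym_diff A (p n -` C \<inter> space \<rho>)"
      using measurable_space[OF p[of n]] by auto
    with C show ?case
      by (intro bexI[of _ "space (R n) - C"]) auto
  qed
qed

lemma (in finite_measure) approximable_Un:
  assumes p: "\<And>n. p n \<in> M \<rightarrow>\<^sub>M R n" and A: "approximable M R p A" and B: "approximable M R p B"
  shows "approximable M R p (A \<union> B)"
  unfolding approximable_def
proof (intro conjI allI impI)
  have [measurable]: "A \<in> sets M" "B \<in> sets M"
    using A B by (auto simp: approximable_def)
  show "A \<union> B \<in> sets M"
    by measurable
  fix e :: real assume "0 < e"
  then have "0 < e / 2"
    by simp
  with A B have "\<forall>\<^sub>F n in sequentially. \<exists>C\<in>sets (R n). measure M (sym_diff A (p n -` C \<inter> space M)) < e / 2"
    "\<forall>\<^sub>F n in sequentially. \<exists>C\<in>sets (R n). measure M (sym_diff B (p n -` C \<inter> space M)) < e / 2"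
    unfolding approximable_def by blast+
  then show "\<forall>\<^sub>F n in sequentially. \<exists>C\<in>sets (R n).
      measure M (sym_diff (A \<union> B) (p n -` C \<inter> space M)) < e"
  proof eventually_elim
    case (elim n)
    then obtain C D where C [measurable]: "C \<in> sets (R n)" and D [measurable]: "D \<in> sets (R n)"
      and lt: "measure M (sym_diff A (p n -` C \<inter> space M)) < e / 2"
        "measure M (sym_diff B (p n -` D \<inter> space M)) < e / 2"
      by blast
    have [measurable]: "p n -` C \<inter> space M \<in> sets M" "p n -` D \<inter> space M \<in> sets M"
      using p[of n] C D by (auto intro: measurable_sets)
    have "measure M (sym_diff (A \<union> B) (p n -` (C \<union> D) \<inter> space M)) \<le>
        measure M (sym_diff A (p n -` C \<inter> space M) \<union> sym_diff B (p n -` D \<inter> space M))"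
      by (intro finite_measure_mono) auto
    also have "\<dots> \<le> measure M (sym_diff A (p n -` C \<inter> space M)) + measure M (sym_diff B (p n -` D \<inter> space M))"
      by (intro measure_Un_le) auto
    also have "\<dots> < e"
      using lt by simp
    finally show ?case
      by (intro bexI[of _ "C \<union> D"]) auto
  qed
qed

text \<open>Finite unions are approximable by induction, and by continuity from below a finite union
  exhausts the countable one up to small measure.\<close>

lemma (in finite_measure) approximable_UN:
  fixes A :: "nat \<Rightarrow> 'a set"
  assumes p: "\<And>n. p n \<in> M \<rightarrow>\<^sub>M R n" and A: "\<And>i. approximable M R p (A i)"
  shows "approximable M R p (\<Union>i. A i)"
proof -
  define U where "U k = (\<Union>i<k. A i)" for k
  have U: "approximable M R p (U k)" for k
  proof (induction k)
    case 0
    show ?case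
      unfolding U_def by (intro approximable_exact) auto
  next
    case (Suc k)
    then show ?case
      using approximable_Un[OF p A[of k]] by (simp add: U_def lessThan_Suc)
  qed
  have [measurable]: "A i \<in> sets M" for i
    using A by (auto simp: approximable_def)
  have [measurable]: "U k \<in> sets M" for k
    using U by (auto simp: approximable_def)
  have "(\<lambda>k. measure M (U k)) \<longlonglongrightarrow> measure M (\<Union>k. U k)"
    by (intro finite_Lim_measure_incseq) (auto simp: incseq_def U_def intro: less_le_trans)
  moreover have "(\<Union>k. U k) = (\<Union>i. A i)"
    by (auto simp: U_def)
  ultimately have lim: "(\<lambda>k. measure M (U k)) \<longlonglongrightarrow> measure M (\<Union>i. A i)"
    by simp
  show ?thesis
    unfolding approximable_def
  proof (intro conjI allI impI)
    show "(\<Union>i. A i) \<in> sets M"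
      by auto
    fix e :: real assume "0 < e"
    then have e2: "0 < e / 2"
      by simp
    \<comment> \<open>\<open>k\<close> is fixed before \<open>n\<close>: half of \<open>e\<close>
      pays for passing to the finite union, the other half for approximating it.\<close>
    then obtain k where k: "measure M (\<Union>i. A i) - e / 2 < measure M (U k)"
      using order_tendstoD(1)[OF lim, of "measure M (\<Union>i. A i) - e / 2"]
      by (auto simp: eventually_sequentially)
    have diff: "measure M ((\<Union>i. A i) - U k) < e / 2"
      using k by (subst finite_measure_Diff) (auto simp: U_def)
    have "\<forall>\<^sub>F n in sequentially. \<exists>C\<in>sets (R n). measure M (sym_diff (U k) (p n -` C \<inter> space M)) < e / 2"
      using U[of k] e2 unfolding approximable_def by blast
    then show "\<forall>\<^sub>F n in sequentially. \<exists>C\<in>sets (R n).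
        measure M (sym_diff (\<Union>i. A i) (p n -` C \<inter> space M)) < e"
    proof eventually_elim
      case (elim n)
      then obtain C where C: "C \<in> sets (R n)" and lt: "measure M (sym_diff (U k) (p n -` C \<inter> space M)) < e / 2"
        by blast
      have [measurable]: "p n -` C \<inter> space M \<in> sets M"
        using p[of n] C by (auto intro: measurable_sets)
      have "measure M (sym_diff (\<Union>i. A i) (p n -` C \<inter> space M)) \<le>
          measure M (((\<Union>i. A i) - U k) \<union> sym_diff (U k) (p n -` C \<inter> space M))"
        by (intro finite_measure_mono) (auto simp: U_def)
      also have "\<dots> \<le> measure M ((\<Union>i. A i) - U k) + measure M (sym_diff (U k) (p n -` C \<inter> space M))"
        by (intro measure_Un_le) auto
      also have "\<dots> < e"
        using lt diff by simp
      finally show ?case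
        using C by blast
    qed
  qed
qed

lemma (in finite_measure) sigma_algebra_approximable:
  assumes p: "\<And>n. p n \<in> M \<rightarrow>\<^sub>M R n"
  shows "sigma_algebra (space M) {A. approximable M R p A}"
  unfolding sigma_algebra_iff2
proof (intro conjI ballI allI impI)
  show "{A. approximable M R p A} \<subseteq> Pow (space M)"
    using sets.sets_into_space by (auto simp: approximable_def)
  show "{} \<in> {A. approximable M R p A}"
    by (auto intro!: approximable_exact)
  show "space M - A \<in> {A. approximable M R p A}" if "A \<in> {A. approximable M R p A}" for A
    using that approximable_Diff[OF p] by auto
  show "(\<Union>i. A i) \<in> {A. approximable M R p A}" if "range A \<subseteq> {A. approximable M R p A}" for A :: "nat \<Rightarrow> 'a set"
    using that by (auto intro!: approximable_UN p)
qed

section \<open>From pointwise limits of observables to events and integrable functions\<close>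

lemma (in finite_measure) tendsto_measure_deviation:
  fixes f :: "'a \<Rightarrow> real"
  assumes [measurable]: "f \<in> borel_measurable M" "\<And>n. F n \<in> borel_measurable M"
    and lim: "\<And>x. x \<in> space M \<Longrightarrow> (\<lambda>n. F n x) \<longlonglongrightarrow> f x" and \<eta>: "0 < \<eta>"
  shows "(\<lambda>n. measure M {x \<in> space M. \<eta> \<le> \<bar>F n x - f x\<bar>}) \<longlonglongrightarrow> 0"
proof -
  \<comment> \<open>Pointwise convergence makes each indicator eventually 0, and the constant 1
    dominates because the measure is finite.\<close>
  have "(\<lambda>n. \<integral>x. indicator {x \<in> space M. \<eta> \<le> \<bar>F n x - f x\<bar>} x \<partial>M) \<longlonglongrightarrow> (\<integral>x. (0::real) \<partial>M)"
  proof (rule integral_dominated_convergence[where w = "\<lambda>_. 1"])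
    show "AE x in M. (\<lambda>n. indicator {x \<in> space M. \<eta> \<le> \<bar>F n x - f x\<bar>} x) \<longlonglongrightarrow> (0::real)"
    proof (rule AE_I2, rule tendsto_eventually)
      fix x assume "x \<in> space M"
      then have "\<forall>\<^sub>F n in sequentially. dist (F n x) (f x) < \<eta>"
        using lim \<eta> by (auto dest: tendstoD)
      then show "\<forall>\<^sub>F n in sequentially. indicator {x \<in> space M. \<eta> \<le> \<bar>F n x - f x\<bar>} x = (0::real)"
        by eventually_elim (auto simp: dist_real_def indicator_def)
    qed
  qed (auto simp: indicator_def)
  then show ?thesis
    by (simp add: Int_absorb2 subset_eq)
qed

lemma (in finite_measure) approximable_less:
  fixes f :: "'a \<Rightarrow> real"
  assumes p: "\<And>n. p n \<in> M \<rightarrow>\<^sub>M R n" and f [measurable]: "f \<in> borel_measurable M"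
    and q: "\<And>n. q n \<in> borel_measurable (R n)"
    and lim: "\<And>x. x \<in> space M \<Longrightarrow> (\<lambda>n. q n (p n x)) \<longlonglongrightarrow> f x"
  shows "approximable M R p {x \<in> space M. f x < c}"
  unfolding approximable_def
proof (intro conjI allI impI)
  show "{x \<in> space M. f x < c} \<in> sets M"
    by measurable
  fix e :: real assume "0 < e"
  then have e2: "0 < e / 2"
    by simp
  \<comment> \<open>Because \<open>f x < c\<close> is strict, these layers below \<open>c\<close>
    decrease to the empty set, so one has small measure even if \<open>{f = c}\<close> carries
    mass.\<close>
  define A where "A k = {x \<in> space M. c - inverse (real (Suc k)) \<le> f x \<and> f x < c}" for k
  have [measurable]: "A k \<in> sets M" for k
    unfolding A_def by measurable
  have "(\<lambda>k. measure M (A k)) \<longlonglongrightarrow> measure M (\<Inter>k. A k)"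
  proof (intro finite_Lim_measure_decseq)
    show "decseq A"
      unfolding decseq_def
    proof (intro allI impI subsetI)
      fix m n x assume "m \<le> n" "x \<in> A n"
      moreover from \<open>m \<le> n\<close> have "inverse (real (Suc n)) \<le> inverse (real (Suc m))"
        by (intro le_imp_inverse_le) auto
      ultimately show "x \<in> A m"
        unfolding A_def mem_Collect_eq by (elim conjE, intro conjI) (assumption, linarith, assumption)
    qed
  qed auto
  moreover have "(\<Inter>k. A k) = {}"
  proof (rule ccontr)
    assume "(\<Inter>k. A k) \<noteq> {}"
    then obtain x where x: "\<And>k. x \<in> A k"
      by blast
    from x have "0 < c - f x"
      by (simp add: A_def)
    then obtain k where "inverse (real (Suc k)) < c - f x"
      using reals_Archimedean by blast
    with x[of k] show False
      by (simp add: A_def)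
  qed
  ultimately have "(\<lambda>k. measure M (A k)) \<longlonglongrightarrow> 0"
    by simp
  then obtain k where k: "measure M (A k) < e / 2"
    using order_tendstoD(2)[of _ 0 sequentially "e / 2"] e2 by (auto simp: eventually_sequentially)
  define \<eta> where "\<eta> = inverse (real (Suc k)) / 2"
  have \<eta>: "0 < \<eta>"
    by (simp add: \<eta>_def)
  have A_k: "A k = {x \<in> space M. c - 2 * \<eta> \<le> f x \<and> f x < c}"
    by (simp add: A_def \<eta>_def)
  have qp [measurable]: "(\<lambda>x. q n (p n x)) \<in> borel_measurable M" for n
    using p q by (rule measurable_compose)
  have "\<forall>\<^sub>F n in sequentially. measure M {x \<in> space M. \<eta> \<le> \<bar>q n (p n x) - f x\<bar>} < e / 2"
    using tendsto_measure_deviation[OF f qp lim \<eta>] e2 by (rule order_tendstoD(2))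
  then show "\<forall>\<^sub>F n in sequentially. \<exists>C\<in>sets (R n).
      measure M (sym_diff {x \<in> space M. f x < c} (p n -` C \<inter> space M)) < e"
  proof eventually_elim
    case (elim n)
    \<comment> \<open>The threshold is the middle of the layer \<open>A k\<close>, whose width is
      \<open>2 * \<eta>\<close>: a misclassified point either lies in the layer or deviates by at
      least \<open>\<eta>\<close>.\<close>
    define C where "C = {z \<in> space (R n). q n z < c - \<eta>}"
    have C: "C \<in> sets (R n)"
      unfolding C_def using q by measurable
    have "measure M (sym_diff {x \<in> space M. f x < c} (p n -` C \<inter> space M)) \<le>
        measure M (A k \<union> {x \<in> space M. \<eta> \<le> \<bar>q n (p n x) - f x\<bar>})"
      using measurable_space[OF p[of n]] \<eta>
      by (intro finite_measure_mono) (auto simp: A_k C_def abs_real_def)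
    also have "\<dots> \<le> measure M (A k) + measure M {x \<in> space M. \<eta> \<le> \<bar>q n (p n x) - f x\<bar>}"
      by (intro measure_Un_le) auto
    also have "\<dots> < e"
      using elim k by simp
    finally show ?case
      using C by blast
  qed
qed

text \<open>Induction over integrable functions, from indicators through sums to dominated limits.
  Measuring the error by \<open>nn_integral\<close> avoids carrying integrability of
  \<open>\<psi> \<circ> p n\<close> along.\<close>

lemma (in finite_measure) approximable_integrable:
  fixes f :: "'a \<Rightarrow> real"
  assumes p: "\<And>n. p n \<in> M \<rightarrow>\<^sub>M R n" and approx: "\<And>A. A \<in> sets M \<Longrightarrow> approximable M R p A"
    and f: "integrable M f" and e: "0 < e"
  shows "\<forall>\<^sub>F n in sequentially. \<exists>\<psi>\<in>borel_measurable (R n).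
    (\<integral>\<^sup>+x. ennreal \<bar>f x - \<psi> (p n x)\<bar> \<partial>M) < ennreal e"
  using f e
proof (induction f arbitrary: e rule: integrable_induct)
  case (base A c)
  \<comment> \<open>The added 1 in the denominator covers \<open>c = 0\<close>.\<close>
  define d where "d = e / (\<bar>c\<bar> + 1)"
  have d: "0 < d" "\<bar>c\<bar> * d < e"
    using base.prems by (auto simp: d_def field_simps add_pos_nonneg)
  have "\<forall>\<^sub>F n in sequentially. \<exists>C\<in>sets (R n). measure M (sym_diff A (p n -` C \<inter> space M)) < d"
    using approx[OF base(1)] d by (auto simp: approximable_def)
  then show ?case
  proof eventually_elim
    case (elim n)
    then obtain C where C: "C \<in> sets (R n)" and lt: "measure M (sym_diff A (p n -` C \<inter> space M)) < d"
      by blast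
    have [measurable]: "p n -` C \<inter> space M \<in> sets M" "A \<in> sets M"
      using p[of n] C base by (auto intro: measurable_sets)
    have "(\<integral>\<^sup>+x. ennreal \<bar>indicator A x *\<^sub>R c - c * indicator C (p n x)\<bar> \<partial>M) =
        (\<integral>\<^sup>+x. ennreal \<bar>c\<bar> * indicator (sym_diff A (p n -` C \<inter> space M)) x \<partial>M)"
      by (intro nn_integral_cong) (auto simp: indicator_def)
    also have "\<dots> = ennreal \<bar>c\<bar> * emeasure M (sym_diff A (p n -` C \<inter> space M))"
      by (intro nn_integral_cmult_indicator) auto
    also have "\<dots> = ennreal (\<bar>c\<bar> * measure M (sym_diff A (p n -` C \<inter> space M)))"
      by (simp add: emeasure_eq_measure ennreal_mult)
    also have "\<dots> < ennreal e"
    proof (rule ennreal_lessI)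
      have "\<bar>c\<bar> * measure M (sym_diff A (p n -` C \<inter> space M)) \<le> \<bar>c\<bar> * d"
        using lt by (intro mult_left_mono) auto
      with d show "\<bar>c\<bar> * measure M (sym_diff A (p n -` C \<inter> space M)) < e"
        by linarith
    qed (use base.prems in simp)
    finally show ?case
      using C by (intro bexI[of _ "\<lambda>z. c * indicator C z"]) auto
  qed
next
  case (add f g)
  from add.prems have e2: "0 < e / 2"
    by simp
  from add.IH(1)[OF e2] add.IH(2)[OF e2] show ?case
  proof eventually_elim
    case (elim n)
    then obtain \<phi> \<psi> where [measurable]: "\<phi> \<in> borel_measurable (R n)" "\<psi> \<in> borel_measurable (R n)"
      and lt: "(\<integral>\<^sup>+x. ennreal \<bar>f x - \<phi> (p n x)\<bar> \<partial>M) < ennreal (e / 2)"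
        "(\<integral>\<^sup>+x. ennreal \<bar>g x - \<psi> (p n x)\<bar> \<partial>M) < ennreal (e / 2)"
      by blast
    note [measurable] = p[of n] borel_measurable_integrable[OF add.hyps(1)]
      borel_measurable_integrable[OF add.hyps(2)]
    have "(\<integral>\<^sup>+x. ennreal \<bar>f x + g x - (\<phi> (p n x) + \<psi> (p n x))\<bar> \<partial>M) \<le>
        (\<integral>\<^sup>+x. ennreal \<bar>f x - \<phi> (p n x)\<bar> + ennreal \<bar>g x - \<psi> (p n x)\<bar> \<partial>M)"
      by (intro nn_integral_mono) (auto simp flip: ennreal_plus)
    also have "\<dots> = (\<integral>\<^sup>+x. ennreal \<bar>f x - \<phi> (p n x)\<bar> \<partial>M) + (\<integral>\<^sup>+x. ennreal \<bar>g x - \<psi> (p n x)\<bar> \<partial>M)"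
      by (intro nn_integral_add) auto
    also have "\<dots> < ennreal (e / 2) + ennreal (e / 2)"
      using lt by (intro add_strict_mono)
    also have "\<dots> = ennreal e"
      using e2 by (simp flip: ennreal_plus)
    finally show ?case
      by (intro bexI[of _ "\<lambda>z. \<phi> z + \<psi> z"]) auto
  qed
next
  case (lim f s)
  note [measurable] = borel_measurable_integrable[OF lim.hyps(1)] borel_measurable_integrable[OF lim.hyps(4)]
  from lim.prems have e2: "0 < e / 2"
    by simp
  have "(\<lambda>i. \<integral>\<^sup>+x. norm (f x - s i x) \<partial>M) \<longlonglongrightarrow> 0"
  \<comment> \<open>The induction rule supplies approximants bounded by
    \<open>2 * norm (f x)\<close>.\<close>
  proof (rule nn_integral_dominated_convergence_norm[where w = "\<lambda>x. 2 * norm (f x)"])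
    show "(\<integral>\<^sup>+x. ennreal (2 * norm (f x)) \<partial>M) < \<infinity>"
      using lim.hyps(4)
      by (simp add: integrable_iff_bounded ennreal_mult nn_integral_cmult ennreal_mult_less_top)
  qed (use lim.hyps in auto)
  then have "\<forall>\<^sub>F i in sequentially. (\<integral>\<^sup>+x. norm (f x - s i x) \<partial>M) < ennreal (e / 2)"
    by (rule order_tendstoD(2)) (use e2 in simp)
  then obtain i where i: "(\<integral>\<^sup>+x. norm (f x - s i x) \<partial>M) < ennreal (e / 2)"
    by (auto simp: eventually_sequentially)
  from lim.IH[OF e2, of i] show ?case
  proof eventually_elim
    case (elim n)
    then obtain \<psi> where [measurable]: "\<psi> \<in> borel_measurable (R n)"
      and lt: "(\<integral>\<^sup>+x. ennreal \<bar>s i x - \<psi> (p n x)\<bar> \<partial>M) < ennreal (e / 2)"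
      by blast
    note [measurable] = p[of n]
    have "(\<integral>\<^sup>+x. ennreal \<bar>f x - \<psi> (p n x)\<bar> \<partial>M) \<le>
        (\<integral>\<^sup>+x. ennreal (norm (f x - s i x)) + ennreal \<bar>s i x - \<psi> (p n x)\<bar> \<partial>M)"
      by (intro nn_integral_mono) (auto simp flip: ennreal_plus)
    also have "\<dots> = (\<integral>\<^sup>+x. norm (f x - s i x) \<partial>M) + (\<integral>\<^sup>+x. ennreal \<bar>s i x - \<psi> (p n x)\<bar> \<partial>M)"
      by (intro nn_integral_add) auto
    also have "\<dots> < ennreal (e / 2) + ennreal (e / 2)"
      using i lt by (intro add_strict_mono)
    also have "\<dots> = ennreal e"
      using e2 by (simp flip: ennreal_plus)
    finally show ?case
      by (intro bexI[of _ \<psi>]) auto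
  qed
qed

section \<open>Convergence of the relative entropies\<close>

text \<open>Data processing gives the upper bound for every \<open>n\<close>; a nearly optimal test
  function, approximated through \<open>p n\<close>, gives the lower one. Approximability is assumed
  for every finite measure because the proof applies it to a dominating measure that it
  constructs.\<close>

lemma kl_divergence_tendsto:
  assumes \<mu>: "prob_space \<mu>" and \<nu>: "prob_space \<nu>" and sets: "sets \<nu> = sets \<mu>"
    and p: "\<And>n. p n \<in> \<mu> \<rightarrow>\<^sub>M R n"
    and approx: "\<And>\<rho> A. finite_measure \<rho> \<Longrightarrow> sets \<rho> = sets \<mu> \<Longrightarrow> A \<in> sets \<mu> \<Longrightarrow> approximable \<rho> R p A"
  shows "(\<lambda>n. kl_divergence (distr \<mu> (R n) (p n)) (distr \<nu> (R n) (p n))) \<longlonglongrightarrow> kl_divergence \<mu> \<nu>"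
proof (rule order_tendstoI)
  interpret \<mu>: prob_space \<mu> by fact
  interpret \<nu>: prob_space \<nu> by fact
  have p': "p n \<in> \<nu> \<rightarrow>\<^sub>M R n" for n
    using p sets by (simp cong: measurable_cong_sets)
  have space: "space \<nu> = space \<mu>"
    using sets by (rule sets_eq_imp_space_eq)
  show "\<forall>\<^sub>F n in sequentially. kl_divergence (distr \<mu> (R n) (p n)) (distr \<nu> (R n) (p n)) < a"
    if "kl_divergence \<mu> \<nu> < a" for a
    by (intro always_eventually allI le_less_trans[OF kl_divergence_distr_le[OF \<mu> \<nu> sets p] that])
  fix a assume "a < kl_divergence \<mu> \<nu>"
  then obtain \<phi> where \<phi>: "\<phi> \<in> bounded_measurable \<mu>" and a: "a < ereal (dv_functional \<mu> \<nu> \<phi>)"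
    unfolding donsker_varadhan[OF \<mu> \<nu> sets] less_SUP_iff by blast
  \<comment> \<open>For real \<open>a\<close> the slack is the whole gap; for
    \<open>a = -\<infinity>\<close> any positive slack works, here 1.\<close>
  obtain d where "0 < d" and d: "a \<le> ereal (dv_functional \<mu> \<nu> \<phi> - d)"
  proof (cases a)
    case (real r)
    with a show thesis
      by (intro that[of "dv_functional \<mu> \<nu> \<phi> - r"]) auto
  qed (use a that[of 1] in auto)
  from \<phi> obtain C where meas: "\<phi> \<in> borel_measurable \<mu>" and C: "\<And>x. \<bar>\<phi> x\<bar> \<le> C"
    by (auto simp: bounded_measurable_def)
  have "0 \<le> C"
    using C[of undefined] by simp
  define K where "K = 1 + exp (2 * C)"
  have "0 < K"
    unfolding K_def by (intro add_pos_pos) auto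
  \<comment> \<open>\<open>K\<close> is the constant of \<open>dv_functional_perturb\<close>, and
    this choice makes the loss \<open>K * e\<close> equal to \<open>d / 2\<close>.\<close>
  define e where "e = d / (2 * K)"
  have e: "0 < e" "K * e < d"
    using \<open>0 < d\<close> \<open>0 < K\<close> by (simp_all add: e_def)
  text \<open>A finite measure dominating both, so that one \<open>L\<^sup>1\<close> approximation of \<open>\<phi>\<close> serves \<open>\<mu>\<close> and \<open>\<nu>\<close>.\<close>
  define \<rho> where "\<rho> = sup_measure' \<mu> \<nu>"
  have sets_\<rho>: "sets \<rho> = sets \<mu>"
    using sets by (simp add: \<rho>_def)
  interpret \<rho>: finite_measure \<rho>
  proof
    have "emeasure \<rho> (space \<mu>) =
        (SUP A\<in>sets \<mu>. emeasure \<mu> (space \<mu> \<inter> A) + emeasure \<nu> (space \<mu> \<inter> - A))"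
      unfolding \<rho>_def using sets by (intro emeasure_sup_measure') auto
    also have "\<dots> \<le> 1 + 1"
      by (intro SUP_least add_mono \<mu>.emeasure_le_1 \<nu>.emeasure_le_1)
    finally have "emeasure \<rho> (space \<mu>) < \<infinity>"
      by (rule le_less_trans) simp
    then show "emeasure \<rho> (space \<rho>) \<noteq> \<infinity>"
      using sets_eq_imp_space_eq[OF sets_\<rho>] by simp
  qed
  have "\<mu> \<le> \<rho>" "\<nu> \<le> \<rho>"
    using sets by (simp_all add: le_measure le_emeasure_sup_measure'1 le_emeasure_sup_measure'2 \<rho>_def)
  then have le: "(\<integral>\<^sup>+x. f x \<partial>\<mu>) \<le> (\<integral>\<^sup>+x. f x \<partial>\<rho>)" "(\<integral>\<^sup>+x. f x \<partial>\<nu>) \<le> (\<integral>\<^sup>+x. f x \<partial>\<rho>)" for f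
    using sets sets_\<rho> by (simp_all add: nn_integral_mono_measure)
  have "\<phi> \<in> bounded_measurable \<rho>"
    using \<phi> sets_\<rho> by (simp add: bounded_measurable_def cong: measurable_cong_sets)
  then have "integrable \<rho> \<phi>"
    by (rule \<rho>.integrable_bounded_measurable)
  moreover have "p n \<in> \<rho> \<rightarrow>\<^sub>M R n" for n
    using p sets_\<rho> by (simp cong: measurable_cong_sets)
  ultimately have "\<forall>\<^sub>F n in sequentially. \<exists>\<psi>\<in>borel_measurable (R n).
      (\<integral>\<^sup>+x. ennreal \<bar>\<phi> x - \<psi> (p n x)\<bar> \<partial>\<rho>) < ennreal e"
    using e(1) approx[OF \<rho>.finite_measure_axioms sets_\<rho>] sets_\<rho>
    by (intro \<rho>.approximable_integrable) auto
  then show "\<forall>\<^sub>F n in sequentially. a < kl_divergence (distr \<mu> (R n) (p n)) (distr \<nu> (R n) (p n))"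
  proof eventually_elim
    case (elim n)
    then obtain \<psi>0 where [measurable]: "\<psi>0 \<in> borel_measurable (R n)"
      and \<psi>0: "(\<integral>\<^sup>+x. ennreal \<bar>\<phi> x - \<psi>0 (p n x)\<bar> \<partial>\<rho>) < ennreal e"
      by blast
    \<comment> \<open>Clipping to the range of \<open>\<phi>\<close> gives the bound
      \<open>C\<close> for all \<open>n\<close>, as the perturbation estimate requires, and never
      increases the distance to \<open>\<phi>\<close>.\<close>
    define \<psi> where "\<psi> z = max (- C) (min C (\<psi>0 z))" for z
    have \<psi> [measurable]: "\<psi> \<in> borel_measurable (R n)"
      unfolding \<psi>_def by measurable
    have \<psi>_le: "\<bar>\<psi> z\<bar> \<le> C" for z
      using \<open>0 \<le> C\<close> by (auto simp: \<psi>_def)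
    have closer: "\<bar>\<phi> x - \<psi> (p n x)\<bar> \<le> \<bar>\<phi> x - \<psi>0 (p n x)\<bar>" for x
      using C[of x] by (auto simp: \<psi>_def)
    note [measurable] = p p' meas
    have [measurable]: "\<phi> \<in> borel_measurable \<nu>"
      using meas sets by (simp cong: measurable_cong_sets)
    have \<psi>p: "(\<lambda>x. \<psi> (p n x)) \<in> borel_measurable \<mu>"
      by measurable
    have L1: "(\<integral>x. \<bar>\<phi> x - \<psi> (p n x)\<bar> \<partial>N) \<le> e"
      if "\<And>f :: _ \<Rightarrow> ennreal. (\<integral>\<^sup>+x. f x \<partial>N) \<le> (\<integral>\<^sup>+x. f x \<partial>\<rho>)"
        "(\<lambda>x. \<bar>\<phi> x - \<psi> (p n x)\<bar>) \<in> borel_measurable N" for N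
    proof -
      have "(\<integral>\<^sup>+x. ennreal \<bar>\<phi> x - \<psi> (p n x)\<bar> \<partial>N) \<le> (\<integral>\<^sup>+x. ennreal \<bar>\<phi> x - \<psi>0 (p n x)\<bar> \<partial>\<rho>)"
        by (rule order_trans[OF that(1)]) (intro nn_integral_mono ennreal_leI closer)
      also have "\<dots> \<le> ennreal e"
        using \<psi>0 by simp
      finally have "(\<integral>\<^sup>+x. ennreal \<bar>\<phi> x - \<psi> (p n x)\<bar> \<partial>N) \<le> ennreal e" .
      then have "enn2real (\<integral>\<^sup>+x. ennreal \<bar>\<phi> x - \<psi> (p n x)\<bar> \<partial>N) \<le> e"
        using e(1) by (intro enn2real_leI) auto
      then show ?thesis
        using that(2) by (subst integral_eq_nn_integral) auto
    qed
    have "dv_functional \<mu> \<nu> \<phi> - K * e \<le> dv_functional \<mu> \<nu> (\<lambda>x. \<psi> (p n x))"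
      unfolding K_def by (rule dv_functional_perturb[OF \<mu> \<nu> sets meas \<psi>p C \<psi>_le]) (intro L1 le; measurable)+
    then have "a < ereal (dv_functional \<mu> \<nu> (\<lambda>x. \<psi> (p n x)))"
      using d e(2) by (intro le_less_trans[OF d]) simp
    also have "\<dots> = ereal (dv_functional (distr \<mu> (R n) (p n)) (distr \<nu> (R n) (p n)) \<psi>)"
      by (simp add: dv_functional_distr[OF p sets \<psi>])
    also have "\<dots> \<le> kl_divergence (distr \<mu> (R n) (p n)) (distr \<nu> (R n) (p n))"
      using \<psi>_le
      by (intro dv_functional_le_kl_divergence \<mu>.prob_space_distr \<nu>.prob_space_distr p p')
        (auto simp: bounded_measurable_def)
    finally show ?case .
  qed
qed

section \<open>Mutual information as relative entropy\<close>

lemma mutual_info_eq_kl_divergence: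
  assumes "prob_space M" and [measurable]: "U \<in> M \<rightarrow>\<^sub>M S" "V \<in> M \<rightarrow>\<^sub>M R"
  shows "mutual_info M S R U V =
    kl_divergence (distr M S U \<Otimes>\<^sub>M distr M R V) (distr M (S \<Otimes>\<^sub>M R) (\<lambda>\<omega>. (U \<omega>, V \<omega>)))"
proof -
  define \<mu> where "\<mu> = distr M S U \<Otimes>\<^sub>M distr M R V"
  define \<nu> where "\<nu> = distr M (S \<Otimes>\<^sub>M R) (\<lambda>\<omega>. (U \<omega>, V \<omega>))"
  have "sets \<mu> = sets (S \<Otimes>\<^sub>M R)"
    unfolding \<mu>_def by (intro sets_pair_measure_cong) auto
  then have "(\<lambda>x. ln (enn2real (RN_deriv \<mu> \<nu> x))) \<in> borel_measurable (S \<Otimes>\<^sub>M R)"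
    using borel_measurable_RN_deriv[of \<mu> \<nu>] by (simp cong: measurable_cong_sets)
  then have "ext_expectation \<nu> (\<lambda>x. ln (enn2real (RN_deriv \<mu> \<nu> x))) =
      ext_expectation M (\<lambda>\<omega>. ln (enn2real (RN_deriv \<mu> \<nu> (U \<omega>, V \<omega>))))"
    unfolding \<nu>_def by (subst ext_expectation_distr) auto
  then show ?thesis
    by (simp add: mutual_info_def kl_divergence_def Let_def flip: \<mu>_def \<nu>_def)
qed

text \<open>The map \<open>p n\<close> is the identity times \<open>q n\<close>. As a product map it
  sends the product of the marginals to the product of the new marginals, and it sends the joint law
  to the new joint law.\<close>

lemma mutual_info_tendsto:
  fixes U :: "'a \<Rightarrow> 'b" and V :: "'a \<Rightarrow> 'c" and q :: "nat \<Rightarrow> 'c \<Rightarrow> 'd"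
  assumes M: "prob_space M" and U: "U \<in> M \<rightarrow>\<^sub>M S" and V: "V \<in> M \<rightarrow>\<^sub>M R"
    and q: "\<And>n. q n \<in> R \<rightarrow>\<^sub>M Q n"
    and approx: "\<And>\<rho> A. finite_measure \<rho> \<Longrightarrow> sets \<rho> = sets (S \<Otimes>\<^sub>M R) \<Longrightarrow> A \<in> sets (S \<Otimes>\<^sub>M R) \<Longrightarrow>
      approximable \<rho> (\<lambda>n. S \<Otimes>\<^sub>M Q n) (\<lambda>n (u, v). (u, q n v)) A"
  shows "(\<lambda>n. mutual_info M S (Q n) U (\<lambda>\<omega>. q n (V \<omega>))) \<longlonglongrightarrow> mutual_info M S R U V"
proof -
  interpret prob_space M by fact
  note [measurable] = U V q
  define \<mu> where "\<mu> = distr M S U \<Otimes>\<^sub>M distr M R V"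
  define \<nu> where "\<nu> = distr M (S \<Otimes>\<^sub>M R) (\<lambda>\<omega>. (U \<omega>, V \<omega>))"
  define p :: "nat \<Rightarrow> 'b \<times> 'c \<Rightarrow> 'b \<times> 'd" where "p n = (\<lambda>(u, v). (u, q n v))" for n
  have sets_\<mu>: "sets \<mu> = sets (S \<Otimes>\<^sub>M R)"
    unfolding \<mu>_def by (intro sets_pair_measure_cong) auto
  have p [measurable]: "p n \<in> S \<Otimes>\<^sub>M R \<rightarrow>\<^sub>M S \<Otimes>\<^sub>M Q n" for n
    unfolding p_def by measurable
  interpret U: prob_space "distr M S U"
    by (rule prob_space_distr) measurable
  interpret V: prob_space "distr M R V"
    by (rule prob_space_distr) measurable
  have qV: "prob_space (distr M (Q n) (\<lambda>\<omega>. q n (V \<omega>)))" for n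
    by (rule prob_space_distr) measurable
  interpret P: pair_prob_space "distr M S U" "distr M R V" ..
  have "(\<lambda>n. kl_divergence (distr \<mu> (S \<Otimes>\<^sub>M Q n) (p n)) (distr \<nu> (S \<Otimes>\<^sub>M Q n) (p n))) \<longlonglongrightarrow> kl_divergence \<mu> \<nu>"
  proof (rule kl_divergence_tendsto)
    show "prob_space \<mu>"
      unfolding \<mu>_def by (rule P.prob_space_axioms)
    show "prob_space \<nu>"
      unfolding \<nu>_def by (rule prob_space_distr) measurable
    show "p n \<in> \<mu> \<rightarrow>\<^sub>M S \<Otimes>\<^sub>M Q n" for n
      using p sets_\<mu> by (simp cong: measurable_cong_sets)
  qed (use approx sets_\<mu> in \<open>auto simp: \<nu>_def p_def[abs_def]\<close>)
  moreover have "distr \<mu> (S \<Otimes>\<^sub>M Q n) (p n) = distr M S U \<Otimes>\<^sub>M distr M (Q n) (\<lambda>\<omega>. q n (V \<omega>))" for n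
  proof -
    have "distr (distr M S U) S (\<lambda>u. u) \<Otimes>\<^sub>M distr (distr M R V) (Q n) (q n) = distr \<mu> (S \<Otimes>\<^sub>M Q n) (p n)"
      unfolding \<mu>_def p_def
      by (rule pair_measure_distr)
        (use qV[of n] in \<open>auto simp: distr_distr comp_def prob_space_imp_sigma_finite\<close>)
    then show ?thesis
      by (simp add: distr_distr comp_def)
  qed
  moreover have "distr \<nu> (S \<Otimes>\<^sub>M Q n) (p n) = distr M (S \<Otimes>\<^sub>M Q n) (\<lambda>\<omega>. (U \<omega>, q n (V \<omega>)))" for n
    unfolding \<nu>_def by (subst distr_distr) (auto simp: comp_def p_def)
  ultimately show ?thesis
    by (simp add: mutual_info_eq_kl_divergence[OF M] \<mu>_def \<nu>_def)
qed

section \<open>Path space and sampling along partitions\<close>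

lemma measurable_path_eval [measurable]: "(\<lambda>y. y t) \<in> borel_measurable (path_space T)"
proof (cases "t \<in> {0..T}")
  case True
  then show ?thesis
    unfolding path_space_def by (intro measurable_restrict_space1 measurable_component_singleton)
next
  \<comment> \<open>Paths are extensional, so evaluation outside \<open>{0..T}\<close> is constant.
    Sampling is thus measurable for \<open>n = 0\<close> as well, where the position of the sampling
    point is not prescribed.\<close>
  case False
  then have "y t = undefined" if "y \<in> space (path_space T)" for y
    using that by (auto simp: path_space_def space_restrict_space space_PiM PiE_def extensional_def)
  then show ?thesis
    by (subst measurable_cong[where g = "\<lambda>_. undefined"]) auto
qed

text \<open>The last partition point not exceeding \<open>s\<close> serves: if it is not
  \<open>T\<close>, the next point exceeds \<open>s\<close>, so the distance is below one
  gap.\<close>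

lemma is_partition_near:
  assumes part: "is_partition T n t" and "1 \<le> n" and s: "s \<in> {0..T}"
  shows "\<exists>i\<le>n. t i \<in> {0..T} \<and> \<bar>t i - s\<bar> \<le> mesh n t"
proof -
  have t: "t 0 = 0" "t n = T" and step: "\<And>i. i < n \<Longrightarrow> t i < t (Suc i)"
    using part by (auto simp: is_partition_def)
  \<comment> \<open>\<open>mesh\<close> indexes a gap by its right endpoint, hence the witness
    \<open>Suc i\<close>.\<close>
  have le_mesh: "t (Suc i) - t i \<le> mesh n t" if "i < n" for i
    unfolding mesh_def using that by (intro Max_ge) (auto intro!: image_eqI[of _ _ "Suc i"])
  define i where "i = (GREATEST i. i \<le> n \<and> t i \<le> s)"
  have i: "i \<le> n \<and> t i \<le> s"
    unfolding i_def by (rule GreatestI_nat[of _ 0 n]) (use s t in auto)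
  have t_nonneg: "0 \<le> t j" if "j \<le> n" for j
    using that
  proof (induction j)
    case (Suc j)
    then show ?case
      using step[of j] by simp
  qed (simp add: t)
  show ?thesis
  proof (cases "i = n")
    case True
    with i s t have "s = T"
      by auto
    moreover have "0 \<le> mesh n t"
      using le_mesh[of 0] step[of 0] \<open>1 \<le> n\<close> by simp
    ultimately show ?thesis
      using t s by (intro exI[of _ n]) auto
  next
    case False
    with i have "i < n"
      by simp
    have "s < t (Suc i)"
    proof (rule ccontr)
      assume "\<not> s < t (Suc i)"
      then have "Suc i \<le> i"
        unfolding i_def by (intro Greatest_le_nat[of _ _ n]) (use \<open>i < n\<close> in \<open>auto simp: i_def\<close>)
      then show False
        by simp
    qed
    with i \<open>i < n\<close> s le_mesh[of i] t_nonneg[of i] show ?thesis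
      by (intro exI[of _ i]) auto
  qed
qed

lemma approximable_path_discretization:
  fixes \<tau> :: "nat \<Rightarrow> nat \<Rightarrow> real"
  assumes part: "\<forall>n\<ge>1. is_partition T n (\<tau> n)" and mesh: "(\<lambda>n. mesh n (\<tau> n)) \<longlonglongrightarrow> 0"
    and \<rho>: "finite_measure \<rho>" and sets: "sets \<rho> = sets (S \<Otimes>\<^sub>M path_space T)" and A: "A \<in> sets (S \<Otimes>\<^sub>M path_space T)"
  shows "approximable \<rho> (\<lambda>n. S \<Otimes>\<^sub>M (\<Pi>\<^sub>M i\<in>{0..n}. borel)) (\<lambda>n (u, y). (u, \<lambda>i\<in>{0..n}. y (\<tau> n i))) A"
    (is "approximable \<rho> ?R ?p A")
proof -
  interpret \<rho>: finite_measure \<rho> by fact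
  have space: "space \<rho> = space (S \<Otimes>\<^sub>M path_space T)"
    using sets by (rule sets_eq_imp_space_eq)
  note [measurable_cong] = sets
  have p: "?p n \<in> \<rho> \<rightarrow>\<^sub>M ?R n" for n
    by measurable
  interpret \<A>: sigma_algebra "space \<rho>" "{A. approximable \<rho> ?R ?p A}"
    using p by (rule \<rho>.sigma_algebra_approximable)
  text \<open>On the sigma-algebra of approximable sets both projections are measurable, so it contains
    the product sigma-algebra.\<close>
  define N where "N = sigma (space \<rho>) {A. approximable \<rho> ?R ?p A}"
  have sets_N: "sets N = {A. approximable \<rho> ?R ?p A}" and space_N: "space N = space \<rho>"
    by (simp_all add: N_def)
  \<comment> \<open>The first coordinate is passed on unchanged, so its events are visible exactly
    at every \<open>n\<close>.\<close>
  have "fst \<in> N \<rightarrow>\<^sub>M S"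
  proof (rule measurableI)
    fix B assume B: "B \<in> sets S"
    have "fst -` B \<inter> space \<rho> \<in> sets \<rho>"
      using B by measurable
    moreover have "\<exists>C\<in>sets (?R n). ?p n -` C \<inter> space \<rho> = fst -` B \<inter> space \<rho>" for n
    proof (intro bexI)
      show "fst -` B \<inter> space (?R n) \<in> sets (?R n)"
        using B by measurable
      show "?p n -` (fst -` B \<inter> space (?R n)) \<inter> space \<rho> = fst -` B \<inter> space \<rho>"
        using measurable_space[OF p[of n]] by fastforce
    qed
    ultimately show "fst -` B \<inter> space N \<in> sets N"
      by (auto simp: sets_N space_N intro: approximable_exact)
  qed (auto simp: space_N space space_pair_measure)
  moreover have "snd \<in> N \<rightarrow>\<^sub>M path_space T"
    unfolding path_space_def
  proof (rule measurable_restrict_space2)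
    show "snd \<in> space N \<rightarrow> {f. continuous_on {0..T} f}"
      by (auto simp: space_N space space_pair_measure path_space_def space_restrict_space)
    have "(\<lambda>x s. snd x s) \<in> N \<rightarrow>\<^sub>M (\<Pi>\<^sub>M t\<in>{0..T}. borel)"
    proof (rule measurable_PiM_single')
      show "(\<lambda>x s. snd x s) \<in> space N \<rightarrow> ({0..T} \<rightarrow>\<^sub>E space borel)"
        by (auto simp: space_N space space_pair_measure path_space_def space_restrict_space space_PiM)
      fix s assume s: "s \<in> {0..T}"
      \<comment> \<open>The guard provides an index at \<open>n = 0\<close> too, so
        \<open>j n \<le> n\<close> always. The index depends on \<open>s\<close> and
        \<open>n\<close> but not on the path, which makes the value at \<open>\<tau> n (j n)\<close>
        a coordinate of the observation; path continuity then recovers the value at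
        \<open>s\<close>.\<close>
      have "\<exists>i\<le>n. 1 \<le> n \<longrightarrow> \<tau> n i \<in> {0..T} \<and> \<bar>\<tau> n i - s\<bar> \<le> mesh n (\<tau> n)" for n
        using is_partition_near[OF part[rule_format, of n] _ s] by (cases "1 \<le> n") auto
      then obtain j where j: "\<And>n. j n \<le> n"
          "\<And>n. 1 \<le> n \<Longrightarrow> \<tau> n (j n) \<in> {0..T} \<and> \<bar>\<tau> n (j n) - s\<bar> \<le> mesh n (\<tau> n)"
        by metis
      have "(\<lambda>n. \<tau> n (j n) - s) \<longlonglongrightarrow> 0"
        by (rule Lim_null_comparison[OF _ mesh]) (use j in \<open>auto intro!: eventually_sequentiallyI[of 1]\<close>)
      then have \<tau>_lim: "(\<lambda>n. \<tau> n (j n)) \<longlonglongrightarrow> s"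
        by (simp add: LIM_zero_iff)
      show "(\<lambda>x. snd x s) \<in> borel_measurable N"
      proof (rule borel_measurableI_less)
        fix c
        have "approximable \<rho> ?R ?p {x \<in> space \<rho>. snd x s < c}"
        proof (rule \<rho>.approximable_less[OF p])
          show "(\<lambda>x. snd x s) \<in> borel_measurable \<rho>"
            by measurable
          show "(\<lambda>z. snd z (j n)) \<in> borel_measurable (?R n)" for n
            by (intro measurable_compose[OF measurable_snd] measurable_component_singleton)
              (simp add: j(1))
          fix x assume "x \<in> space \<rho>"
          then have cont: "continuous_on {0..T} (snd x)"
            by (auto simp: space space_pair_measure path_space_def space_restrict_space)
          have "(\<lambda>n. snd x (\<tau> n (j n))) \<longlonglongrightarrow> snd x s"
            by (rule continuous_on_tendsto_compose[OF cont \<tau>_lim s])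
              (use j in \<open>auto intro!: eventually_sequentiallyI[of 1]\<close>)
          then show "(\<lambda>n. snd (?p n x) (j n)) \<longlonglongrightarrow> snd x s"
            using j(1) by (simp add: case_prod_unfold)
        qed
        then show "{x \<in> space N. snd x s < c} \<in> sets N"
          by (simp add: sets_N space_N)
      qed
    qed
    then show "snd \<in> N \<rightarrow>\<^sub>M (\<Pi>\<^sub>M t\<in>{0..T}. borel)"
      by simp
  qed
  \<comment> \<open>This map is the identity, so its measurability says that \<open>N\<close>
    contains the product sigma-algebra.\<close>
  ultimately have "(\<lambda>x. (fst x, snd x)) \<in> N \<rightarrow>\<^sub>M S \<Otimes>\<^sub>M path_space T"
    by (rule measurable_Pair)
  from measurable_sets[OF this A] have "A \<inter> space \<rho> \<in> sets N"
    by (simp add: space_N vimage_def)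
  then show ?thesis
    using sets.sets_into_space[of A \<rho>] A sets by (simp add: sets_N Int_absorb2)
qed

theorem theorem2p3:
  fixes M :: "'a measure"
    and T :: real
    and W B Y :: "'a \<Rightarrow> real \<Rightarrow> real"
    and g :: "real \<Rightarrow> (real \<Rightarrow> real) \<Rightarrow> (real \<Rightarrow> real) \<Rightarrow> real"
    and \<tau> :: "nat \<Rightarrow> nat \<Rightarrow> real"
  assumes "T > 0"
    and "prob_space M"
    and W: "W \<in> M \<rightarrow>\<^sub>M path_space T"
    and B: "standard_brownian_motion M T B"
    and indep: "prob_space.indep_var M (path_space T) W (path_space T) B"
    and Y: "Y \<in> M \<rightarrow>\<^sub>M path_space T"
    and channel: "AE \<omega> in M. \<forall>t\<in>{0..T}.
      Y \<omega> t = (LBINT s:{0..t}. g s (stopped T (W \<omega>) s) (stopped T (Y \<omega>) s)) + B \<omega> t"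
    and d: "\<exists>L>0. \<forall>s1\<in>{0..T}. \<forall>s2\<in>{0..T}. \<forall>s3\<in>{0..T}.
      \<forall>t1\<in>{0..T}. \<forall>t2\<in>{0..T}. \<forall>t3\<in>{0..T}.
      \<forall>u\<in>space (path_space T). \<forall>v\<in>space (path_space T).
      \<forall>y\<in>space (path_space T). \<forall>z\<in>space (path_space T).
        \<bar>g s1 (stopped T u s2) (stopped T y s3) - g t1 (stopped T v t2) (stopped T z t3)\<bar>
          \<le> L * (\<bar>s1 - t1\<bar> + path_dist u s2 v t2 + path_dist y s3 z t3)"
    and e: "\<exists>L>0. \<forall>w\<in>space (path_space T). \<forall>y\<in>space (path_space T). \<forall>t\<in>{0..T}.
        \<bar>g t (stopped T w t) (stopped T y t)\<bar> \<le> L * (1 + path_norm w t + path_norm y t)"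
    and f1: "\<exists>\<epsilon>>0. (\<integral>\<^sup>+\<omega>. ennreal (exp (\<epsilon> * (path_norm (W \<omega>) T)\<^sup>2)) \<partial>M) < \<infinity>"
    and f2: "\<forall>K>0. \<exists>\<epsilon>>0.
      (\<integral>\<^sup>+\<omega>. ennreal (exp (K * (SUP (s, t)\<in>close_pairs T \<epsilon>. (W \<omega> s - W \<omega> t)\<^sup>2))) \<partial>M) < \<infinity>"
    and f3: "\<exists>L>0. \<forall>\<epsilon>>0.
      (\<integral>\<^sup>+\<omega>. ennreal (SUP (s, t)\<in>close_pairs T \<epsilon>. (W \<omega> s - W \<omega> t) ^ 4) \<partial>M) \<le> ennreal (L * \<epsilon>\<^sup>2)"
    and partition: "\<forall>n\<ge>1. is_partition T n (\<tau> n)"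
    and mesh: "(\<lambda>n. mesh n (\<tau> n)) \<longlonglongrightarrow> 0"
  shows "(\<lambda>n. mutual_info M (path_space T) (\<Pi>\<^sub>M i\<in>{0..n}. borel) W (\<lambda>\<omega>. \<lambda>i\<in>{0..n}. Y \<omega> (\<tau> n i)))
           \<longlonglongrightarrow> mutual_info M (path_space T) (path_space T) W Y"
\<comment> \<open>The samples are the image of the output path under a measurable evaluation map
  \<open>q n\<close>, and the mesh condition yields approximability of all events in the product of
  the two path spaces.\<close>
proof (rule mutual_info_tendsto[OF \<open>prob_space M\<close> W Y, where q = "\<lambda>n y. \<lambda>i\<in>{0..n}. y (\<tau> n i)"])
  show "(\<lambda>y. \<lambda>i\<in>{0..n}. y (\<tau> n i)) \<in> path_space T \<rightarrow>\<^sub>M (\<Pi>\<^sub>M i\<in>{0..n}. borel)" for n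
    by measurable
qed (rule approximable_path_discretization[OF partition mesh])

end
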